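(* Let $n\in\mathbb{N}$, $n\ge 1$. For $\varepsilon>0$ define $w_\varepsilon\in H^2_{loc}(\mathbb{R}^n)$ by $w_\varepsilon(x):=\varepsilon|x|^2$. Then there exists $\varepsilon_0=\varepsilon_0(n)>0$ such that for all $\varepsilon\in(0,\varepsilon_0)$ the function $w_\varepsilon$ is not a global minimizer of $\mathcal{F}$.
   Context: For $\Omega\subset\mathbb{R}^n$ open and bounded and $u\in H^2(\Omega)$, the two-sided biharmonic Alt-Caffarelli functional is $\mathcal{F}(u,\Omega):=\int_\Omega(\Delta u)^2\,\mathrm{d}x+|\{x\in\Omega:u(x)\neq 0\}|$, where $|\cdot|$ of a set is Lebesgue measure. A function $u\in H^2_{loc}(\mathbb{R}^n)$ is a global minimizer of $\mathcal{F}$ if for all bounded open sets $\Omega\subset\mathbb{R}^n$ and all $v\in H^2(\Omega)$ with $v-u\in H^2_0(\Omega)$ one has $\mathcal{F}(u,\Omega)\le\mathcal{F}(v,\Omega)$. Here $H^2_0(\Omega)$ is the closure of $C_0^\infty(\Omega)$ in $H^2(\Omega)$. *)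

theory Defs
  imports "HOL-Analysis.Analysis"
begin

primrec iterated_partial :: "'n list \<Rightarrow> (real ^ 'n \<Rightarrow> real) \<Rightarrow> real ^ 'n \<Rightarrow> real" where
  "iterated_partial [] f = f"
| "iterated_partial (i # is) f =
     (\<lambda>x. frechet_derivative (iterated_partial is f) (at x) (axis i 1))"

text \<open>
  Differentiability of every iterated partial derivative makes all of them continuous, so the
  first conjunct below says that the function is infinitely often continuously differentiable.
  Test functions on \<open>\<Omega>\<close> are functions on the whole space that vanish outside a compact
  subset of \<open>\<Omega>\<close>.
\<close>

definition test_functions :: "(real ^ 'n) set \<Rightarrow> (real ^ 'n \<Rightarrow> real) set" where
  "test_functions \<Omega> = {\<phi>. (\<forall>is. iterated_partial is \<phi> differentiable_on UNIV) \<and>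
     compact (closure (support_on UNIV \<phi>)) \<and> closure (support_on UNIV \<phi>) \<subseteq> \<Omega>}"

definition locally_integrable :: "(real ^ 'n) set \<Rightarrow> (real ^ 'n \<Rightarrow> real) \<Rightarrow> bool" where
  "locally_integrable \<Omega> f \<longleftrightarrow>
     (\<forall>K. compact K \<and> K \<subseteq> \<Omega> \<longrightarrow> set_integrable lebesgue K f)"

definition L2 :: "(real ^ 'n) set \<Rightarrow> (real ^ 'n \<Rightarrow> real) set" where
  "L2 \<Omega> = {f. set_borel_measurable lebesgue \<Omega> f \<and>
     set_integrable lebesgue \<Omega> (\<lambda>x. (f x)\<^sup>2)}"

definition has_weak_deriv ::
  "(real ^ 'n) set \<Rightarrow> 'n list \<Rightarrow> (real ^ 'n \<Rightarrow> real) \<Rightarrow> (real ^ 'n \<Rightarrow> real) \<Rightarrow> bool" where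
  "has_weak_deriv \<Omega> is u g \<longleftrightarrow>
     locally_integrable \<Omega> u \<and> locally_integrable \<Omega> g \<and>
     (\<forall>\<phi>\<in>test_functions \<Omega>.
        (LINT x:\<Omega>|lebesgue. u x * iterated_partial is \<phi> x) =
        (-1) ^ length is * (LINT x:\<Omega>|lebesgue. g x * \<phi> x))"

text \<open>
  A weak derivative is unique only almost everywhere on \<open>\<Omega>\<close>; the choice of a representative
  does not affect any integral over \<open>\<Omega>\<close>. Likewise, elements of the spaces below are functions
  on the whole space whose values outside \<open>\<Omega>\<close> are irrelevant.
\<close>

definition weak_deriv ::
  "(real ^ 'n) set \<Rightarrow> 'n list \<Rightarrow> (real ^ 'n \<Rightarrow> real) \<Rightarrow> real ^ 'n \<Rightarrow> real" where
  "weak_deriv \<Omega> is u = (SOME g. has_weak_deriv \<Omega> is u g)"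

definition sobolev_H :: "nat \<Rightarrow> (real ^ 'n) set \<Rightarrow> (real ^ 'n \<Rightarrow> real) set" where
  "sobolev_H k \<Omega> = {u\<in>L2 \<Omega>. \<forall>is. length is \<le> k \<longrightarrow> (\<exists>g\<in>L2 \<Omega>. has_weak_deriv \<Omega> is u g)}"

text \<open>
  The sum runs over ordered index lists, so mixed derivatives are counted with multiplicity:
  for \<open>k = 2\<close> the squared norm is the integral of
  \<open>\<bar>u\<bar>\<^sup>2 + \<bar>\<nabla>u\<bar>\<^sup>2 + \<bar>D\<^sup>2u\<bar>\<^sup>2\<close> with the Frobenius norm of the Hessian.
\<close>

definition sobolev_norm :: "nat \<Rightarrow> (real ^ 'n) set \<Rightarrow> (real ^ 'n \<Rightarrow> real) \<Rightarrow> real" where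
  "sobolev_norm k \<Omega> u =
     sqrt (\<Sum>is | length is \<le> k. LINT x:\<Omega>|lebesgue. (weak_deriv \<Omega> is u x)\<^sup>2)"

definition sobolev_H0 :: "nat \<Rightarrow> (real ^ 'n) set \<Rightarrow> (real ^ 'n \<Rightarrow> real) set" where
  "sobolev_H0 k \<Omega> = {u\<in>sobolev_H k \<Omega>.
     \<forall>e>0. \<exists>\<phi>\<in>test_functions \<Omega>. sobolev_norm k \<Omega> (\<lambda>x. u x - \<phi> x) < e}"

definition sobolev_H_loc :: "nat \<Rightarrow> (real ^ 'n) set \<Rightarrow> (real ^ 'n \<Rightarrow> real) set" where
  "sobolev_H_loc k \<Omega> =
     {u. \<forall>V. open V \<and> compact (closure V) \<and> closure V \<subseteq> \<Omega> \<longrightarrow> u \<in> sobolev_H k V}"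

definition weak_laplacian :: "(real ^ 'n) set \<Rightarrow> (real ^ 'n \<Rightarrow> real) \<Rightarrow> real ^ 'n \<Rightarrow> real" where
  "weak_laplacian \<Omega> u x = (\<Sum>i\<in>UNIV. weak_deriv \<Omega> [i, i] u x)"

definition alt_caffarelli :: "(real ^ 'n \<Rightarrow> real) \<Rightarrow> (real ^ 'n) set \<Rightarrow> real" where
  "alt_caffarelli u \<Omega> =
     (LINT x:\<Omega>|lebesgue. (weak_laplacian \<Omega> u x)\<^sup>2) + measure lebesgue {x\<in>\<Omega>. u x \<noteq> 0}"

definition global_minimizer :: "(real ^ 'n \<Rightarrow> real) \<Rightarrow> bool" where
  "global_minimizer u \<longleftrightarrow> u \<in> sobolev_H_loc 2 UNIV \<and>
     (\<forall>\<Omega> v. open \<Omega> \<and> bounded \<Omega> \<and> v \<in> sobolev_H 2 \<Omega> \<and> (\<lambda>x. v x - u x) \<in> sobolev_H0 2 \<Omega> \<longrightarrow>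
        alt_caffarelli u \<Omega> \<le> alt_caffarelli v \<Omega>)"

end

theory Submission
  imports Defs
begin

text \<open>
  The function \<open>w \<epsilon>\<close> vanishes only at the origin, so on a ball \<open>\<Omega>\<close> it pays the full price \<open>\<bar>\<Omega>\<bar>\<close> in the
  measure term. Cutting it off costs little energy when \<open>\<epsilon>\<close> is small. Let \<open>\<eta>\<close> be a smooth cutoff that
  equals 1 on the unit ball and 0 outside the ball of radius 2, and compare with
  \<open>v = \<epsilon> h\<close>, where \<open>h x = \<bar>x\<bar>\<^sup>2 (1 - \<eta> x)\<close>. The difference \<open>v - w \<epsilon>\<close> is a test function, hence
  \<open>v\<close> is admissible. As \<open>v\<close> vanishes on the unit ball \<open>B\<close>,
  its functional is at most \<open>\<epsilon>\<^sup>2 C + \<bar>\<Omega>\<bar> - \<bar>B\<bar>\<close>, where \<open>C\<close> is the integral of \<open>(\<Delta>h)\<^sup>2\<close> over \<open>\<Omega>\<close>, whereas that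
  of \<open>w \<epsilon>\<close> is at least \<open>\<bar>\<Omega>\<bar>\<close>. For \<open>\<epsilon>\<^sup>2 C < \<bar>B\<bar>\<close> the function \<open>w \<epsilon>\<close> is not minimal.

  The substance of the proof lies in the weak formulation. The functional and the Sobolev norm are
  written in terms of an arbitrarily chosen weak derivative, so the value \<open>\<epsilon>\<^sup>2 C\<close> for the energy of
  \<open>v\<close>, and already the fact that the zero function has Sobolev norm zero, depend on two statements:
  smooth functions have their classical derivatives as weak derivatives
  (\<open>smooth_has_weak_deriv\<close>, by integration by parts), and weak derivatives are unique up to null sets
  (\<open>has_weak_deriv_unique\<close>, by the fundamental lemma of the calculus of variations). Both the cutoff
  and the test functions for the fundamental lemma come from \<open>exp (-1/t)\<close>; their smoothness follows from
  an inductively defined class of functions that is closed under partial derivatives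
  (\<open>smooth_expr_partials\<close>).
\<close>

section \<open>Functions that are flat at the origin\<close>

text \<open>
  The derivative of \<open>exp (-1/t)\<close> is \<open>exp (-1/t) / t\<^sup>2\<close>; dividing by further powers of \<open>t\<close> gives
  a family that is closed under differentiation, which makes smoothness at the origin a statement
  about all members at once instead of about one function and its unwieldy higher derivatives.
\<close>
definition flat :: "nat \<Rightarrow> real \<Rightarrow> real" where
  "flat k t = (if t \<le> 0 then 0 else exp (- 1 / t) / t ^ k)"

lemma flat_nonpos [simp]: "t \<le> 0 \<Longrightarrow> flat k t = 0"
  by (simp add: flat_def)

lemma flat_pos: "t > 0 \<Longrightarrow> flat k t > 0"
  by (simp add: flat_def)

lemma flat_nonneg [simp]: "flat k t \<ge> 0"
  by (simp add: flat_def)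

lemma flat_0_le_1: "flat 0 t \<le> 1"
  by (simp add: flat_def)

text \<open>
  This carries all the analysis at the origin: the difference quotient of \<open>flat k\<close> there is
  \<open>flat (Suc k)\<close>.
\<close>
lemma flat_tendsto_0: "(flat k \<longlongrightarrow> 0) (at 0)"
proof -
  have "((\<lambda>t. (inverse t) ^ k / exp (inverse t)) \<longlongrightarrow> (0::real)) (at_right 0)"
    by (rule filterlim_compose [OF tendsto_power_div_exp_0 filterlim_inverse_at_top_right])
  moreover have "\<forall>\<^sub>F t in at_right 0. (inverse t) ^ k / exp (inverse t) = flat k t"
    unfolding eventually_at_right_field
    by (intro exI[of _ 1]) (auto simp: flat_def exp_minus field_simps)
  ultimately have R: "(flat k \<longlongrightarrow> 0) (at_right 0)"
    by (rule Lim_transform_eventually)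
  have "\<forall>\<^sub>F t in at_left 0. 0 = flat k t"
    unfolding eventually_at_left_field by (intro exI[of _ "-1"]) auto
  then have "(flat k \<longlongrightarrow> 0) (at_left 0)"
    by (rule Lim_transform_eventually [OF tendsto_const])
  with R show ?thesis
    using filterlim_split_at by blast
qed

lemma flat_has_real_derivative:
  "(flat k has_real_derivative flat (k + 2) t - k * flat (k + 1) t) (at t)"
proof -
  consider "t < 0" | "t = 0" | "t > 0" by linarith
  then show ?thesis
  proof cases
    case 1
    have "((\<lambda>_. 0) has_real_derivative 0) (at t)" by simp
    then have "(flat k has_real_derivative 0) (at t)"
      by (rule has_field_derivative_transform_within_open [of _ _ _ "{..<0}"]) (use 1 in auto)
    with 1 show ?thesis by simp
  next
    case 2
    have "\<forall>\<^sub>F h in at 0. flat (Suc k) h = (flat k (0 + h) - flat k 0) / h"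
      by (rule eventually_at_filter [THEN iffD2]) (auto simp: flat_def)
    then have "((\<lambda>h. (flat k (0 + h) - flat k 0) / h) \<longlongrightarrow> 0) (at 0)"
      by (rule Lim_transform_eventually [OF flat_tendsto_0])
    with 2 show ?thesis by (simp add: DERIV_def)
  next
    case 3
    have "((\<lambda>t. exp (- 1 / t) / t ^ k) has_real_derivative flat (k + 2) t - k * flat (k + 1) t) (at t)"
    proof (cases "k = 0")
      case True
      then show ?thesis using 3
        by (auto intro!: derivative_eq_intros simp: flat_def field_simps power2_eq_square)
    next
      case False
      then have "t ^ (k - Suc 0) = t ^ k / t"
        using 3 by (simp add: power_diff)
      then show ?thesis using 3
        by (auto intro!: derivative_eq_intros simp: flat_def field_simps power2_eq_square)
    qed
    then show ?thesis
      by (rule has_field_derivative_transform_within_open [of _ _ _ "{0<..}"])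
        (use 3 in \<open>auto simp: flat_def\<close>)
  qed
qed

text \<open>
  Products of these dilations approximate indicator functions of open boxes by smooth functions
  from below.
\<close>
lemma flat_0_dilation_tendsto:
  "(\<lambda>m. flat 0 (real m * t)) \<longlonglongrightarrow> indicat_real {0<..} t"
proof (cases "t > 0")
  case True
  have "(\<lambda>m. exp (- inverse (real m) / t)) \<longlonglongrightarrow> exp (- 0 / t)"
    by (intro tendsto_intros lim_inverse_n) (use True in auto)
  moreover have "\<forall>\<^sub>F m in sequentially. exp (- inverse (real m) / t) = flat 0 (real m * t)"
    using eventually_gt_at_top [of 0]
    by eventually_elim (use True in \<open>auto simp: flat_def field_simps not_le\<close>)
  ultimately show ?thesis
    using True by (auto intro: Lim_transform_eventually)
next
  case False
  then have "flat 0 (real m * t) = 0" for m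
    by (intro flat_nonpos mult_nonneg_nonpos) auto
  with False show ?thesis by simp
qed

section \<open>A class of smooth functions closed under partial derivatives\<close>

abbreviation partial :: "'n \<Rightarrow> (real ^ 'n \<Rightarrow> real) \<Rightarrow> real ^ 'n \<Rightarrow> real" where
  "partial i f \<equiv> (\<lambda>x. frechet_derivative f (at x) (axis i 1))"

text \<open>
  A function built from these operations is smooth for a purely formal reason: each operation is
  differentiable, and its partial derivatives are again built from the same operations. The class
  is large enough for the cutoff and for approximate indicators of boxes.
\<close>
inductive_set smooth_expr :: "(real ^ 'n \<Rightarrow> real) set" where
  const: "(\<lambda>_. c) \<in> smooth_expr"
| coord: "(\<lambda>x. x $ i) \<in> smooth_expr"
| add: "f \<in> smooth_expr \<Longrightarrow> g \<in> smooth_expr \<Longrightarrow> (\<lambda>x. f x + g x) \<in> smooth_expr"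
| mult: "f \<in> smooth_expr \<Longrightarrow> g \<in> smooth_expr \<Longrightarrow> (\<lambda>x. f x * g x) \<in> smooth_expr"
| flat: "f \<in> smooth_expr \<Longrightarrow> (\<lambda>x. flat k (f x)) \<in> smooth_expr"
| inverse: "f \<in> smooth_expr \<Longrightarrow> (\<And>x. f x \<noteq> 0) \<Longrightarrow> (\<lambda>x. inverse (f x)) \<in> smooth_expr"

lemma smooth_expr_cmult: "f \<in> smooth_expr \<Longrightarrow> (\<lambda>x. c * f x) \<in> smooth_expr"
  by (rule smooth_expr.mult [OF smooth_expr.const])

lemma smooth_expr_diff:
  "f \<in> smooth_expr \<Longrightarrow> g \<in> smooth_expr \<Longrightarrow> (\<lambda>x. f x - g x) \<in> smooth_expr"
  using smooth_expr.add [OF _ smooth_expr_cmult [of g "-1"], of f] by simp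

lemma smooth_expr_sum:
  "(\<And>j. j \<in> J \<Longrightarrow> f j \<in> smooth_expr) \<Longrightarrow> (\<lambda>x. \<Sum>j\<in>J. f j x) \<in> smooth_expr"
  by (induction J rule: infinite_finite_induct) (auto intro: smooth_expr.const smooth_expr.add)

lemma smooth_expr_prod:
  "(\<And>j. j \<in> J \<Longrightarrow> f j \<in> smooth_expr) \<Longrightarrow> (\<lambda>x. \<Prod>j\<in>J. f j x) \<in> smooth_expr"
  by (induction J rule: infinite_finite_induct) (auto intro: smooth_expr.const smooth_expr.mult)

lemma smooth_expr_norm_square: "(\<lambda>x. (norm x)\<^sup>2) \<in> smooth_expr"
proof -
  have "(\<lambda>x::real^'n. \<Sum>i\<in>UNIV. x $ i * x $ i) \<in> smooth_expr"
    by (intro smooth_expr_sum smooth_expr.mult smooth_expr.coord)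
  then show ?thesis
    by (simp add: power2_norm_eq_inner inner_vec_def)
qed

lemma partial_eq: "(\<And>x. (f has_derivative D x) (at x)) \<Longrightarrow> partial i f = (\<lambda>x. D x (axis i 1))"
  using frechet_derivative_at by metis

lemma smooth_expr_partials:
  assumes "f \<in> smooth_expr"
  shows "(\<forall>x. f differentiable (at x)) \<and> (\<forall>i. partial i f \<in> smooth_expr)"
  using assms
proof induction
  case (const c)
  have "partial i (\<lambda>_. c) = (\<lambda>_. 0)" for i :: 'a
    by (simp add: fun_eq_iff)
  then show ?case by (auto intro: smooth_expr.const)
next
  case (coord j)
  have D: "((\<lambda>x. x $ j) has_derivative (\<lambda>x. x $ j)) (at x)" for x :: "real ^ 'a"
    by (rule bounded_linear_imp_has_derivative [OF bounded_linear_vec_nth])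
  show ?case
    by (auto simp: partial_eq [OF D] differentiable_def intro: D smooth_expr.const)
next
  case (add f g)
  then have D: "((\<lambda>x. f x + g x) has_derivative
      (\<lambda>h. frechet_derivative f (at x) h + frechet_derivative g (at x) h)) (at x)" for x
    by (intro has_derivative_add) (auto simp: frechet_derivative_works [symmetric])
  show ?case
    unfolding partial_eq [OF D]
    using add D by (auto simp: differentiable_def intro: smooth_expr.add)
next
  case (mult f g)
  then have D: "((\<lambda>x. f x * g x) has_derivative
      (\<lambda>h. f x * frechet_derivative g (at x) h + frechet_derivative f (at x) h * g x)) (at x)" for x
    by (intro has_derivative_mult) (auto simp: frechet_derivative_works [symmetric])
  show ?case
    unfolding partial_eq [OF D]
    using mult D by (auto simp: differentiable_def intro!: smooth_expr.add smooth_expr.mult)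
next
  case (flat f k)
  then have "(f has_derivative frechet_derivative f (at x)) (at x)" for x
    by (auto simp: frechet_derivative_works [symmetric])
  from has_derivative_compose [OF this flat_has_real_derivative [of k, unfolded has_field_derivative_def]]
  \<comment> \<open>Differentiation raises the index \<open>k\<close>, so all the functions \<open>flat k\<close> must be among the constructors.\<close>
  have D: "((\<lambda>x. flat k (f x)) has_derivative
      (\<lambda>h. (flat (k + 2) (f x) - k * flat (k + 1) (f x)) * frechet_derivative f (at x) h)) (at x)" for x
    by simp
  show ?case
    unfolding partial_eq [OF D]
    using flat D
    by (auto simp: differentiable_def simp del: add_2_eq_Suc' 
        intro!: smooth_expr.mult smooth_expr_diff smooth_expr_cmult smooth_expr.flat)
next
  case (inverse f)
  then have "((\<lambda>x. inverse (f x)) has_derivative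
      (\<lambda>h. - (inverse (f x) * frechet_derivative f (at x) h * inverse (f x)))) (at x)" for x
    by (intro Deriv.has_derivative_inverse) (auto simp: frechet_derivative_works [symmetric])
  then have D: "((\<lambda>x. inverse (f x)) has_derivative
      (\<lambda>h. - 1 * (inverse (f x) * frechet_derivative f (at x) h * inverse (f x)))) (at x)" for x
    by simp
  show ?case
    unfolding partial_eq [OF D]
    using inverse D
    by (auto simp only: differentiable_def simp_thms
        intro!: smooth_expr.mult smooth_expr.const smooth_expr.inverse)
qed

definition smooth :: "(real ^ 'n \<Rightarrow> real) \<Rightarrow> bool" where
  "smooth f \<longleftrightarrow> (\<forall>is x. iterated_partial is f differentiable (at x))"

lemma smooth_expr_smooth:
  assumes "f \<in> smooth_expr"
  shows "smooth f"
proof -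
  have "iterated_partial is f \<in> smooth_expr" for "is"
    by (induction "is") (use assms smooth_expr_partials in auto)
  then show ?thesis
    using smooth_expr_partials by (auto simp: smooth_def)
qed

lemma iterated_partial_append:
  "iterated_partial (is @ js) f = iterated_partial is (iterated_partial js f)"
  by (induction "is") auto

lemma smooth_iterated_partial: "smooth f \<Longrightarrow> smooth (iterated_partial is f)"
  by (simp add: smooth_def iterated_partial_append [symmetric])

lemma smooth_partial: "smooth f \<Longrightarrow> smooth (partial i f)"
  using smooth_iterated_partial [of f "[i]"] by simp

lemma smooth_differentiable: "smooth f \<Longrightarrow> f differentiable (at x)"
  unfolding smooth_def by (metis iterated_partial.simps(1))

lemma smooth_continuous: "smooth f \<Longrightarrow> continuous_on S f"
  using smooth_differentiable
  by (meson continuous_at_imp_continuous_on differentiable_imp_continuous_within)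

text \<open>
  Derivatives are local: wherever a function vanishes on an open set, so do its derivatives. Hence
  all derivatives of a test function share one compact support.
\<close>
lemma partial_vanishes:
  assumes "open U" "\<And>x. x \<in> U \<Longrightarrow> f x = 0" "x \<in> U"
  shows "partial i f x = 0"
proof -
  have "(f has_derivative (\<lambda>_. 0)) (at x)"
    by (rule has_derivative_transform_within_open [of "\<lambda>_. 0" _ _ _ U]) (use assms in auto)
  then show ?thesis by (simp add: frechet_derivative_at [symmetric])
qed

lemma iterated_partial_vanishes:
  assumes "open U" "\<And>x. x \<in> U \<Longrightarrow> f x = 0" "x \<in> U"
  shows "iterated_partial is f x = 0"
  using assms(3)
proof (induction "is" arbitrary: x)
  case (Cons i "is")
  then show ?case using partial_vanishes [OF assms(1)] by auto
qed (use assms in auto)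

lemma smooth_test_function:
  assumes "smooth f" "compact K" "K \<subseteq> \<Omega>" "\<And>x. x \<notin> K \<Longrightarrow> f x = 0"
  shows "f \<in> test_functions \<Omega>"
proof -
  have "closure (support_on UNIV f) \<subseteq> K"
    using assms by (intro closure_minimal compact_imp_closed) (auto simp: support_on_def)
  moreover then have "compact (closure (support_on UNIV f))"
    using \<open>compact K\<close> by (metis closed_closure compact_Int_closed inf.absorb_iff2)
  ultimately show ?thesis
    using assms
    by (auto simp: test_functions_def smooth_def intro: differentiable_at_imp_differentiable_on)
qed

lemma test_function_smooth: "\<phi> \<in> test_functions \<Omega> \<Longrightarrow> smooth \<phi>"
  by (simp add: test_functions_def smooth_def differentiable_on_def)

lemma test_function_support:
  assumes "\<phi> \<in> test_functions \<Omega>"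
  obtains K where "compact K" "K \<subseteq> \<Omega>" "\<And>is x. x \<notin> K \<Longrightarrow> iterated_partial is \<phi> x = 0"
proof
  let ?K = "closure (support_on UNIV \<phi>)"
  show "compact ?K" "?K \<subseteq> \<Omega>"
    using assms by (auto simp: test_functions_def)
  show "iterated_partial is \<phi> x = 0" if "x \<notin> ?K" for "is" x
  proof (rule iterated_partial_vanishes)
    show "\<phi> y = 0" if "y \<in> - ?K" for y
      using that closure_subset [of "support_on UNIV \<phi>"] by (auto simp: support_on_def)
  qed (use that in auto)
qed

section \<open>Integration by parts and weak derivatives of smooth functions\<close>

lemma integral_lborel_translation:
  fixes f :: "'a::euclidean_space \<Rightarrow> real"
  assumes "f \<in> borel_measurable borel"
  shows "(LINT x|lborel. f (a + x)) = integral\<^sup>L lborel f"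
proof -
  have "integral\<^sup>L lborel f = integral\<^sup>L (distr lborel borel ((+) a)) f"
    by (simp add: lborel_distr_plus)
  also have "\<dots> = (LINT x|lborel. f (a + x))"
    using assms by (intro integral_distr) auto
  finally show ?thesis ..
qed

lemma integrable_continuous_compact_support:
  fixes f :: "'a::euclidean_space \<Rightarrow> real"
  assumes "continuous_on UNIV f" "compact K" "\<And>x. x \<notin> K \<Longrightarrow> f x = 0"
  shows "integrable lborel f"
proof -
  have "(\<lambda>x. indicator K x *\<^sub>R f x) = f"
    using assms(3) by (auto simp: indicator_def fun_eq_iff)
  then show ?thesis
    using borel_integrable_compact [OF assms(2) continuous_on_subset [OF assms(1)]] by simp
qed

text \<open>
  Translation invariance makes every difference quotient of \<open>f\<close> in direction \<open>i\<close> integrate to zero.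
  The quotients converge to the partial derivative, and the mean value theorem bounds them by a
  multiple of the indicator of a fixed ball, so the limit integrates to zero as well.
\<close>
lemma integral_partial_compact_support:
  fixes f :: "real ^ 'n \<Rightarrow> real"
  assumes diff: "\<And>x. f differentiable (at x)"
    and cont: "continuous_on UNIV (partial i f)"
    and K: "compact K" "\<And>x. x \<notin> K \<Longrightarrow> f x = 0"
  shows "integral\<^sup>L lborel (partial i f) = 0"
proof -
  define e :: "real ^ 'n" where "e = axis i 1"
  define s where "s m x = real (Suc m) * (f (inverse (real (Suc m)) *\<^sub>R e + x) - f x)" for m x
  have norm_e: "norm e = 1" by (simp add: e_def)
  have contf: "continuous_on UNIV f"
    using diff by (meson continuous_at_imp_continuous_on differentiable_imp_continuous_within)
  then have [measurable]: "f \<in> borel_measurable borel"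
    by (rule borel_measurable_continuous_onI)
  have intf: "integrable lborel f"
    by (rule integrable_continuous_compact_support [OF contf K])
  have line: "((\<lambda>t. f (x + t *\<^sub>R e)) has_real_derivative partial i f (x + t *\<^sub>R e)) (at t)" for x t
  proof -
    have "((\<lambda>t. x + t *\<^sub>R e) has_derivative (\<lambda>t. t *\<^sub>R e)) (at t)"
      by (auto intro!: derivative_eq_intros)
    moreover have D: "(f has_derivative frechet_derivative f (at (x + t *\<^sub>R e))) (at (x + t *\<^sub>R e))"
      using diff frechet_derivative_works by blast
    ultimately have "((\<lambda>t. f (x + t *\<^sub>R e)) has_derivative
        (\<lambda>s. frechet_derivative f (at (x + t *\<^sub>R e)) (s *\<^sub>R e))) (at t)"
      by (rule has_derivative_compose)
    then show ?thesis
      using linear_scale [OF has_derivative_linear [OF D]]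
      by (simp add: has_field_derivative_def e_def mult_commute_abs)
  qed
  obtain R where R: "R > 0" "\<And>x. x \<in> K \<Longrightarrow> norm x \<le> R"
    using compact_imp_bounded [OF K(1)] by (meson bounded_pos)
  obtain M where M: "\<And>x. x \<in> cball 0 (R + 2) \<Longrightarrow> \<bar>partial i f x\<bar> \<le> M"
  proof -
    have "bounded (partial i f ` cball 0 (R + 2))"
      by (intro compact_imp_bounded compact_continuous_image continuous_on_subset [OF cont]) auto
    then obtain B where "\<forall>x\<in>cball 0 (R + 2). \<bar>partial i f x\<bar> \<le> B"
      by (auto simp: bounded_iff)
    then show ?thesis
      using that by blast
  qed
  \<comment> \<open>The steps have length at most 1: inside the ball of radius \<open>R + 1\<close> the segment stays in the ball where \<open>M\<close> is a bound, and outside it both endpoints avoid the support.\<close>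
  have bound: "\<bar>s m x\<bar> \<le> indicator (cball 0 (R + 1)) x * M" for m x
  proof (cases "norm x \<le> R + 1")
    case True
    let ?h = "inverse (real (Suc m))"
    have h: "0 < ?h" "?h \<le> 1" by (auto simp: field_simps)
    obtain z where z: "0 < z" "z < ?h"
      "f (x + ?h *\<^sub>R e) - f (x + 0 *\<^sub>R e) = (?h - 0) * partial i f (x + z *\<^sub>R e)"
      using MVT2 [OF h(1) line] by blast
    have "norm (x + z *\<^sub>R e) \<le> R + 2"
      using norm_triangle_ineq [of x "z *\<^sub>R e"] True z h norm_e by simp
    then have "\<bar>partial i f (x + z *\<^sub>R e)\<bar> \<le> M" by (intro M) auto
    moreover have "s m x = partial i f (x + z *\<^sub>R e)"
      using z(3) by (simp add: s_def add.commute)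
    ultimately show ?thesis using True by simp
  next
    case False
    have "norm (inverse (real (Suc m)) *\<^sub>R e) \<le> 1"
      by (simp add: norm_e field_simps)
    then have "\<not> norm (inverse (real (Suc m)) *\<^sub>R e + x) \<le> R"
      using False norm_triangle_ineq2 [of x "- (inverse (real (Suc m)) *\<^sub>R e)"]
      by (simp add: add.commute)
    then have "f (inverse (real (Suc m)) *\<^sub>R e + x) = 0" "f x = 0"
      using False K(2) R(2) by force+
    then show ?thesis using False by (simp add: s_def)
  qed
  have lim: "(\<lambda>m. s m x) \<longlonglongrightarrow> partial i f x" for x
  proof -
    have "((\<lambda>h. (f (x + h *\<^sub>R e) - f x) / h) \<longlongrightarrow> partial i f x) (at 0)"
      using line [of x 0] by (simp add: DERIV_def)
    moreover have "filterlim (\<lambda>m. inverse (real (Suc m))) (at 0) sequentially"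
      using LIMSEQ_inverse_real_of_nat by (auto simp: filterlim_at simp del: of_nat_Suc)
    ultimately have "(\<lambda>m. (f (x + inverse (real (Suc m)) *\<^sub>R e) - f x) / inverse (real (Suc m)))
        \<longlonglongrightarrow> partial i f x"
      by (rule filterlim_compose)
    then show ?thesis by (simp add: s_def add.commute mult.commute divide_inverse)
  qed
  have [measurable]: "partial i f \<in> borel_measurable borel"
    by (rule borel_measurable_continuous_onI [OF cont])
  have "(\<lambda>m. integral\<^sup>L lborel (s m)) \<longlonglongrightarrow> integral\<^sup>L lborel (partial i f)"
  proof (rule integral_dominated_convergence)
    show "integrable lborel (\<lambda>x::real^'n. indicator (cball 0 (R + 1)) x * M)"
      by (intro integrable_mult_left integrable_real_indicator) (simp_all only: emeasure_compact_finite compact_cball sets_lborel borel_closed closed_cball)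
    show "s m \<in> borel_measurable lborel" for m
      unfolding s_def by measurable
  qed (use bound lim in \<open>auto intro!: AE_I2\<close>)
  moreover have "integral\<^sup>L lborel (s m) = 0" for m
  proof -
    have "integrable lborel (\<lambda>x. f (inverse (real (Suc m)) *\<^sub>R e + x))"
    proof (rule integrable_continuous_compact_support)
      show "continuous_on UNIV (\<lambda>x. f (inverse (real (Suc m)) *\<^sub>R e + x))"
        by (intro continuous_on_compose2 [OF contf] continuous_intros) auto
      show "compact ((+) (- (inverse (real (Suc m)) *\<^sub>R e)) ` K)"
        by (rule compact_translation [OF K(1)])
      show "f (inverse (real (Suc m)) *\<^sub>R e + x) = 0"
        if "x \<notin> (+) (- (inverse (real (Suc m)) *\<^sub>R e)) ` K" for x
        using that by (intro K(2)) (force simp: image_iff algebra_simps)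
    qed
    then show ?thesis
      using intf integral_lborel_translation [of f]
      by (simp add: s_def [abs_def] del: of_nat_Suc)
  qed
  ultimately show ?thesis
    by (simp add: LIMSEQ_const_iff)
qed

text \<open>
  The integrands in the definition of a weak derivative vanish outside \<open>\<Omega>\<close>, so integrals over \<open>\<Omega>\<close>
  become integrals over the whole space, where translation invariance is available.
\<close>
lemma set_integral_test_function:
  assumes "\<phi> \<in> test_functions \<Omega>" "continuous_on UNIV u"
  shows "(LINT x:\<Omega>|lebesgue. u x * iterated_partial is \<phi> x) =
    (LINT x|lborel. u x * iterated_partial is \<phi> x)"
proof -
  obtain K where K: "K \<subseteq> \<Omega>" "\<And>is x. x \<notin> K \<Longrightarrow> iterated_partial is \<phi> x = 0"
    using test_function_support [OF assms(1)] by metis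
  have "(\<lambda>x. indicator \<Omega> x *\<^sub>R (u x * iterated_partial is \<phi> x)) = (\<lambda>x. u x * iterated_partial is \<phi> x)"
    using K by (fastforce simp: indicator_def fun_eq_iff)
  moreover have "(\<lambda>x. u x * iterated_partial is \<phi> x) \<in> borel_measurable borel"
    by (intro borel_measurable_continuous_onI continuous_on_mult assms(2)
        smooth_continuous smooth_iterated_partial test_function_smooth [OF assms(1)])
  ultimately show ?thesis
    by (simp add: set_lebesgue_integral_def integral_completion)
qed

text \<open>
  The outermost derivative of the test function is the first to be moved onto \<open>u\<close>, where it ends up
  innermost. Hence the index list is reversed on the right-hand side.
\<close>
lemma integration_by_parts_test_function:
  assumes "smooth u" "\<phi> \<in> test_functions \<Omega>"
  shows "(LINT x|lborel. u x * iterated_partial is \<phi> x) =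
    (-1) ^ length is * (LINT x|lborel. iterated_partial (rev is) u x * \<phi> x)"
  using assms(1)
proof (induction "is" arbitrary: u)
  case Nil
  then show ?case by simp
next
  case (Cons i "is")
  define P where "P = iterated_partial is \<phi>"
  have u': "smooth (partial i u)"
    using Cons.prems by (rule smooth_partial)
  have smoothP: "smooth P"
    unfolding P_def by (intro smooth_iterated_partial test_function_smooth [OF assms(2)])
  obtain K where K: "compact K" "\<And>is x. x \<notin> K \<Longrightarrow> iterated_partial is \<phi> x = 0"
    using test_function_support [OF assms(2)] by metis
  have "(u has_derivative frechet_derivative u (at x)) (at x)"
    "(P has_derivative frechet_derivative P (at x)) (at x)" for x
    using Cons.prems smoothP
    by (auto simp: frechet_derivative_works [symmetric] smooth_differentiable)
  then have D: "((\<lambda>x. u x * P x) has_derivative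
      (\<lambda>h. u x * frechet_derivative P (at x) h + frechet_derivative u (at x) h * P x)) (at x)" for x
    by (rule has_derivative_mult)
  have contP: "continuous_on UNIV P" "continuous_on UNIV (partial i P)"
    using smoothP by (auto intro: smooth_continuous smooth_partial)
  have contu: "continuous_on UNIV u" "continuous_on UNIV (partial i u)"
    using Cons.prems u' by (auto intro: smooth_continuous)
  have int: "integrable lborel (\<lambda>x. u x * partial i P x)" "integrable lborel (\<lambda>x. partial i u x * P x)"
  proof -
    show "integrable lborel (\<lambda>x. u x * partial i P x)"
      using K(2) [of _ "i # is"]
      by (intro integrable_continuous_compact_support [OF _ K(1)] continuous_on_mult contP contu)
        (simp add: P_def)
    show "integrable lborel (\<lambda>x. partial i u x * P x)"
      using K(2) [of _ "is"]
      by (intro integrable_continuous_compact_support [OF _ K(1)] continuous_on_mult contP contu)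
        (simp add: P_def)
  qed
  have "integral\<^sup>L lborel (partial i (\<lambda>x. u x * P x)) = 0"
  proof (rule integral_partial_compact_support [OF _ _ K(1)])
    show "(\<lambda>x. u x * P x) differentiable (at x)" for x
      using D differentiable_def by blast
    show "continuous_on UNIV (partial i (\<lambda>x. u x * P x))"
      unfolding partial_eq [OF D] by (intro continuous_on_add continuous_on_mult contP contu)
    show "u x * P x = 0" if "x \<notin> K" for x
      using K(2) [OF that] by (simp add: P_def)
  qed
  then have "(LINT x|lborel. u x * partial i P x) = - (LINT x|lborel. partial i u x * P x)"
    unfolding partial_eq [OF D] using int by simp
  with Cons.IH [OF u'] show ?case
    by (simp add: P_def iterated_partial_append)
qed

lemma continuous_locally_integrable:
  assumes "continuous_on UNIV f"
  shows "locally_integrable \<Omega> f"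
  unfolding locally_integrable_def set_integrable_def
proof (intro allI impI)
  fix K assume "compact K \<and> K \<subseteq> \<Omega>"
  then have int: "integrable lborel (\<lambda>x. indicator K x *\<^sub>R f x)"
    using assms by (intro borel_integrable_compact) (auto intro: continuous_on_subset)
  then show "integrable lebesgue (\<lambda>x. indicator K x *\<^sub>R f x)"
    using integrable_completion [OF borel_measurable_integrable [OF int]] by simp
qed

lemma smooth_has_weak_deriv:
  assumes "smooth u"
  shows "has_weak_deriv \<Omega> is u (iterated_partial (rev is) u)"
  unfolding has_weak_deriv_def
proof (intro conjI ballI continuous_locally_integrable)
  show cont: "continuous_on UNIV u" "continuous_on UNIV (iterated_partial (rev is) u)"
    using assms by (auto intro: smooth_continuous smooth_iterated_partial)
  fix \<phi> assume \<phi>: "\<phi> \<in> test_functions \<Omega>"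
  show "(LINT x:\<Omega>|lebesgue. u x * iterated_partial is \<phi> x) =
      (-1) ^ length is * (LINT x:\<Omega>|lebesgue. iterated_partial (rev is) u x * \<phi> x)"
    using integration_by_parts_test_function [OF assms \<phi>, of "is"]
      set_integral_test_function [OF \<phi> cont(1), of "is"]
      set_integral_test_function [OF \<phi> cont(2), of "[]"] by simp
qed

lemma continuous_L2:
  assumes "continuous_on UNIV f" "open \<Omega>" "bounded \<Omega>"
  shows "f \<in> L2 \<Omega>"
proof -
  have [measurable]: "f \<in> borel_measurable borel"
    using assms(1) by (rule borel_measurable_continuous_onI)
  have "set_borel_measurable lebesgue \<Omega> f"
    unfolding set_borel_measurable_def using assms(2)
    by (intro measurable_completion) measurable
  moreover have "set_integrable lebesgue (closure \<Omega>) (\<lambda>x. (f x)\<^sup>2)"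
  proof -
    have "continuous_on UNIV (\<lambda>x. (f x)\<^sup>2)"
      using assms(1) by (intro continuous_intros)
    from continuous_locally_integrable [OF this, of UNIV] show ?thesis
      using assms(3) by (auto simp: locally_integrable_def compact_closure)
  qed
  then have "set_integrable lebesgue \<Omega> (\<lambda>x. (f x)\<^sup>2)"
    by (rule set_integrable_subset) (use assms closure_subset in auto)
  ultimately show ?thesis by (simp add: L2_def)
qed

lemma smooth_sobolev_H:
  assumes "smooth u" "open \<Omega>" "bounded \<Omega>"
  shows "u \<in> sobolev_H k \<Omega>"
proof -
  have "iterated_partial is u \<in> L2 \<Omega>" for "is"
    using assms by (intro continuous_L2 smooth_continuous smooth_iterated_partial) auto
  then show ?thesis
    using smooth_has_weak_deriv [OF assms(1)] smooth_continuous [OF assms(1)]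
      continuous_L2 assms(2,3)
    unfolding sobolev_H_def by blast
qed

section \<open>The fundamental lemma of the calculus of variations\<close>

text \<open>
  The indicator of \<open>box a b\<close> is the limit of test functions with values in \<open>[0, 1]\<close> and support in
  \<open>cbox a b\<close>, so dominated convergence passes from test functions to the box.
\<close>
lemma integral_box_zero_if_annihilates_test_functions:
  fixes g :: "real ^ 'n \<Rightarrow> real"
  assumes ab: "cbox a b \<subseteq> \<Omega>"
    and g: "set_integrable lebesgue (cbox a b) g"
    and ann: "\<And>\<phi>. \<phi> \<in> test_functions \<Omega> \<Longrightarrow> (LINT x:\<Omega>|lebesgue. g x * \<phi> x) = 0"
  shows "(LINT x:box a b|lebesgue. g x) = 0"
proof -
  define \<phi> where "\<phi> m x =
    (\<Prod>i\<in>UNIV. flat 0 (real m * (x $ i - a $ i)) * flat 0 (real m * (b $ i - x $ i)))"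
    for m and x :: "real ^ 'n"
  have smooth: "\<phi> m \<in> smooth_expr" for m
    unfolding \<phi>_def
    by (intro smooth_expr_prod smooth_expr.mult smooth_expr.flat smooth_expr_cmult
        smooth_expr_diff smooth_expr.coord smooth_expr.const)
  have outside: "\<phi> m x = 0" if x: "x \<notin> cbox a b" for m x
  proof -
    obtain i where "x $ i < a $ i \<or> b $ i < x $ i"
      using x by (auto simp: mem_box_cart not_le)
    then have "flat 0 (real m * (x $ i - a $ i)) * flat 0 (real m * (b $ i - x $ i)) = 0"
      by (auto simp: mult_nonneg_nonpos)
    then show ?thesis
      unfolding \<phi>_def by (intro prod_zero) auto
  qed
  have test: "\<phi> m \<in> test_functions \<Omega>" for m
    using smooth_test_function [OF smooth_expr_smooth [OF smooth] compact_cbox ab outside] .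
  have bound: "0 \<le> \<phi> m x \<and> \<phi> m x \<le> 1" for m x
    unfolding \<phi>_def by (auto intro!: prod_nonneg prod_le_1 mult_le_one flat_0_le_1)
  have lim: "(\<lambda>m. \<phi> m x) \<longlonglongrightarrow> indicator (box a b) x" for x
  proof -
    have "(\<lambda>m. \<phi> m x) \<longlonglongrightarrow>
        (\<Prod>i\<in>UNIV. indicator {0<..} (x $ i - a $ i) * indicator {0<..} (b $ i - x $ i))"
      unfolding \<phi>_def by (intro tendsto_prod tendsto_mult flat_0_dilation_tendsto)
    moreover have "(\<Prod>i\<in>UNIV. indicator {0<..} (x $ i - a $ i) * indicator {0<..} (b $ i - x $ i)) =
        indicat_real (box a b) x"
    proof (cases "x \<in> box a b")
      case True
      then show ?thesis by (auto simp: mem_box_cart)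
    next
      case False
      then obtain i where "\<not> a $ i < x $ i \<or> \<not> x $ i < b $ i"
        by (auto simp: mem_box_cart)
      then have "indicat_real {0<..} (x $ i - a $ i) * indicat_real {0<..} (b $ i - x $ i) = 0"
        by auto
      then have "(\<Prod>i\<in>UNIV. indicator {0<..} (x $ i - a $ i) * indicator {0<..} (b $ i - x $ i)) = (0 :: real)"
        by (intro prod_zero) auto
      with False show ?thesis by simp
    qed
    ultimately show ?thesis by simp
  qed
  define G where "G x = indicator (cbox a b) x * g x" for x
  have G: "integrable lebesgue G"
    using g by (simp add: set_integrable_def G_def [abs_def])
  then have [measurable]: "G \<in> borel_measurable lebesgue" by auto
  have [measurable]: "\<phi> m \<in> borel_measurable lebesgue" for m
    by (intro measurable_completion) (simp add: borel_measurable_continuous_onI smooth smooth_expr_smooth smooth_continuous)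
  have "(\<lambda>m. LINT x|lebesgue. G x * \<phi> m x) \<longlonglongrightarrow> (LINT x|lebesgue. G x * indicator (box a b) x)"
  proof (rule integral_dominated_convergence [where w = "\<lambda>x. \<bar>G x\<bar>"])
    show "AE x in lebesgue. (\<lambda>m. G x * \<phi> m x) \<longlonglongrightarrow> G x * indicator (box a b) x"
      by (intro AE_I2 tendsto_mult tendsto_const lim)
    show "AE x in lebesgue. norm (G x * \<phi> m x) \<le> \<bar>G x\<bar>" for m
      using bound by (intro AE_I2) (auto simp: abs_mult intro: mult_left_le)
    show "(\<lambda>x. G x * indicator (box a b) x) \<in> borel_measurable lebesgue"
      by (intro borel_measurable_times borel_measurable_indicator) auto
  qed (use G in auto)
  moreover have "(LINT x|lebesgue. G x * \<phi> m x) = 0" for m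
  proof -
    have "(\<lambda>x. G x * \<phi> m x) = (\<lambda>x. indicator \<Omega> x *\<^sub>R (g x * \<phi> m x))"
      using outside ab by (fastforce simp: G_def indicator_def fun_eq_iff)
    then show ?thesis
      using ann [OF test] by (simp add: set_lebesgue_integral_def)
  qed
  ultimately have "(LINT x|lebesgue. G x * indicator (box a b) x) = 0"
    by (simp add: LIMSEQ_const_iff)
  moreover have "(\<lambda>x. G x * indicator (box a b) x) = (\<lambda>x. indicator (box a b) x *\<^sub>R g x)"
    using box_subset_cbox [of a b] by (auto simp: G_def indicator_def fun_eq_iff)
  ultimately show ?thesis
    by (simp add: set_lebesgue_integral_def)
qed

text \<open>
  Boxes form an intersection-stable generator of the Borel sets, and the sets over which an
  integrable function has integral zero form a Dynkin system once the whole space is one of them. A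
  Borel measurable representative \<open>h\<close> then has zero integral over every Borel set, which forces it
  to vanish almost everywhere.
\<close>
lemma AE_zero_if_box_integrals_zero:
  fixes f :: "'a::euclidean_space \<Rightarrow> real"
  assumes f: "integrable lebesgue f"
    and zero: "\<And>a b. (LINT x:box a b|lebesgue. f x) = 0"
  shows "AE x in lebesgue. f x = 0"
proof -
  obtain h where h: "h \<in> borel_measurable lborel" "AE x in lborel. f x = h x"
    using completion_ex_borel_measurable_real [of f lborel] f by auto
  have AE: "AE x in lebesgue. f x = h x"
    using h(2) by (rule AE_completion)
  have hm: "h \<in> borel_measurable lebesgue"
    using h(1) by (rule measurable_completion)
  have "integrable lebesgue h"
    using f integrable_cong_AE [of f lebesgue h] AE hm by auto
  then have int: "integrable lborel h"
    using integrable_completion [OF h(1)] by simp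
  have set_int: "set_integrable lborel A h" if "A \<in> sets borel" for A
    unfolding set_integrable_def using int that by (intro integrable_mult_indicator) auto
  have box: "(LINT x:box a b|lborel. h x) = 0" for a b
  proof -
    have "(LINT x:box a b|lborel. h x) = (LINT x:box a b|lebesgue. h x)"
      unfolding set_lebesgue_integral_def
      using h(1) by (intro integral_completion [symmetric]) auto
    also have "\<dots> = (LINT x:box a b|lebesgue. f x)"
      unfolding set_lebesgue_integral_def
      using AE hm f
      by (intro integral_cong_AE borel_measurable_scaleR borel_measurable_indicator)
        (auto elim: eventually_mono)
    finally show ?thesis using zero by simp
  qed
  have UNIV: "(LINT x:UNIV|lborel. h x) = 0"
  proof -
    let ?B = "\<lambda>n. box (- (real n *\<^sub>R One)) (real n *\<^sub>R One) :: 'a set"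
    have "(\<lambda>n. LINT x:?B n|lborel. h x) \<longlonglongrightarrow> (LINT x:(\<Union>n. ?B n)|lborel. h x)"
      by (rule set_integral_cont_up) (auto simp: incseq_def box_def intro: set_int order_less_le_trans)
    then show ?thesis
      by (simp add: box UN_box_eq_UNIV LIMSEQ_const_iff)
  qed
  have "(LINT x:A|lborel. h x) = 0" if "A \<in> sets lborel" for A
  proof -
    let ?E = "range (\<lambda>(a, b). box a b :: 'a set)"
    have "Int_stable ?E"
      by (auto simp: Int_stable_def box_Int_box)
    moreover have "?E \<subseteq> Pow UNIV" by simp
    moreover have "A \<in> sigma_sets UNIV ?E"
      using that by (simp add: borel_eq_box)
    ultimately show ?thesis
    proof (induction rule: sigma_sets_induct_disjoint)
      case (compl A)
      then have "A \<in> sets borel" by (simp add: borel_eq_box)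
      then have "(LINT x:A \<union> (UNIV - A)|lborel. h x) =
          (LINT x:A|lborel. h x) + (LINT x:UNIV - A|lborel. h x)"
        by (intro set_integral_Un set_int) auto
      with compl UNIV show ?case by simp
    next
      case (union A)
      then have "A i \<in> sets borel" for i by (auto simp: borel_eq_box)
      then have "(LINT x:(\<Union>i. A i)|lborel. h x) = (\<Sum>i. LINT x:A i|lborel. h x)"
        using union(1)
        by (intro lebesgue_integral_countable_add set_int) (auto simp: disjoint_family_on_def)
      with union show ?case by simp
    next
      case (basic A)
      then show ?case using box by auto
    next
      case empty
      show ?case by (simp add: set_lebesgue_integral_def)
    qed
  qed
  then have "AE x in lborel. h x = 0"
    by (intro sigma_finite_measure.density_zero [OF lborel.sigma_finite_measure_axioms] int)
  then have "AE x in lebesgue. h x = 0"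
    by (rule AE_completion)
  with AE show ?thesis by eventually_elim simp
qed

text \<open>
  Local integrability only gives integrability on boxes whose closure lies in \<open>\<Omega>\<close>. Countably many
  of them cover \<open>\<Omega>\<close>, and a countable union of null sets is null.
\<close>
lemma fundamental_lemma_calculus_of_variations:
  fixes g :: "real ^ 'n \<Rightarrow> real"
  assumes "open \<Omega>" and g: "locally_integrable \<Omega> g"
    and ann: "\<And>\<phi>. \<phi> \<in> test_functions \<Omega> \<Longrightarrow> (LINT x:\<Omega>|lebesgue. g x * \<phi> x) = 0"
  shows "AE x in lebesgue. x \<in> \<Omega> \<longrightarrow> g x = 0"
proof -
  define \<B> where "\<B> = {box a b | a b. cbox a b \<subseteq> \<Omega>}"
  have "\<Union>\<B> = \<Omega>"
  proof
    show "\<Union>\<B> \<subseteq> \<Omega>"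
      using box_subset_cbox by (fastforce simp: \<B>_def)
    show "\<Omega> \<subseteq> \<Union>\<B>"
    proof
      fix x assume "x \<in> \<Omega>"
      then obtain a b where "cbox a b \<subseteq> \<Omega>" "x \<in> box a b"
        using assms(1) open_contains_cbox by metis
      then show "x \<in> \<Union>\<B>" by (auto simp: \<B>_def)
    qed
  qed
  obtain \<C> where C: "\<C> \<subseteq> \<B>" "countable \<C>" "\<Union>\<C> = \<Union>\<B>"
    using Lindelof [of \<B>] by (auto simp: \<B>_def)
  have "AE x in lebesgue. x \<in> B \<longrightarrow> g x = 0" if BC: "B \<in> \<C>" for B
  proof -
    obtain a b where B: "B = box a b" "cbox a b \<subseteq> \<Omega>"
      using BC C(1) by (auto simp: \<B>_def)
    have "set_integrable lebesgue (cbox a b) g"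
      using g B(2) by (simp add: locally_integrable_def)
    then have int: "set_integrable lebesgue (box a b) g"
      by (rule set_integrable_subset) (auto simp: box_subset_cbox)
    have "AE x in lebesgue. indicator (box a b) x *\<^sub>R g x = 0"
    proof (rule AE_zero_if_box_integrals_zero)
      show "integrable lebesgue (\<lambda>x. indicator (box a b) x *\<^sub>R g x)"
        using int by (simp add: set_integrable_def)
      fix c d :: "real ^ 'n"
      obtain p q where pq: "box c d \<inter> box a b = box p q"
        by (auto simp: box_Int_box)
      show "(LINT x:box c d|lebesgue. indicator (box a b) x *\<^sub>R g x) = 0"
      proof (cases "box p q = {}")
        case True
        then have "(\<lambda>x. indicator (box c d) x *\<^sub>R indicator (box a b) x *\<^sub>R g x) = (\<lambda>_. 0)"
          using pq by (auto simp: indicator_def fun_eq_iff)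
        then show ?thesis by (simp only: set_lebesgue_integral_def integral_zero)
      next
        case False
        then have "cbox p q \<subseteq> cbox a b"
          using pq by (metis box_subset_cbox closure_box closure_minimal closed_cbox inf_le2 subset_trans)
        then have "cbox p q \<subseteq> \<Omega>"
          using B(2) by blast
        moreover from this have "set_integrable lebesgue (cbox p q) g"
          using g by (simp add: locally_integrable_def)
        ultimately have "(LINT x:box p q|lebesgue. g x) = 0"
          using ann by (rule integral_box_zero_if_annihilates_test_functions)
        moreover have "(\<lambda>x. indicator (box c d) x *\<^sub>R indicator (box a b) x *\<^sub>R g x) =
            (\<lambda>x. indicator (box p q) x *\<^sub>R g x)"
          by (simp add: pq [symmetric] indicator_inter_arith fun_eq_iff)
        ultimately show ?thesis by (simp only: set_lebesgue_integral_def)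
      qed
    qed
    then show ?thesis
      by (rule eventually_mono) (auto simp: B)
  qed
  then have "AE x in lebesgue. \<forall>B\<in>\<C>. x \<in> B \<longrightarrow> g x = 0"
    unfolding AE_ball_countable [OF C(2)] by blast
  then have "AE x in lebesgue. x \<in> \<Union>\<C> \<longrightarrow> g x = 0"
    by (rule eventually_mono) auto
  with C(3) \<open>\<Union>\<B> = \<Omega>\<close> show ?thesis by simp
qed

section \<open>Uniqueness of weak derivatives and its consequences\<close>

lemma locally_integrable_times_test_function:
  assumes "locally_integrable \<Omega> g" "\<phi> \<in> test_functions \<Omega>"
  shows "set_integrable lebesgue \<Omega> (\<lambda>x. g x * \<phi> x)"
proof -
  obtain K where K: "compact K" "K \<subseteq> \<Omega>" "\<And>x. x \<notin> K \<Longrightarrow> \<phi> x = 0"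
    using test_function_support [OF assms(2)] iterated_partial.simps(1) by metis
  have cont: "continuous_on UNIV \<phi>"
    using assms(2) by (intro smooth_continuous test_function_smooth)
  obtain M where M: "\<And>x. x \<in> K \<Longrightarrow> \<bar>\<phi> x\<bar> \<le> M"
  proof -
    have "bounded (\<phi> ` K)"
      by (intro compact_imp_bounded compact_continuous_image continuous_on_subset [OF cont] K) auto
    then obtain B where "\<forall>x\<in>K. \<bar>\<phi> x\<bar> \<le> B"
      by (auto simp: bounded_iff)
    then show ?thesis using that by blast
  qed
  have int: "integrable lebesgue (\<lambda>x. indicator K x * g x)"
    using assms(1) K by (auto simp: locally_integrable_def set_integrable_def)
  have "integrable lebesgue (\<lambda>x. (indicator K x * g x) * \<phi> x)"
  proof (rule Bochner_Integration.integrable_bound)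
    show "integrable lebesgue (\<lambda>x. M * (indicator K x * g x))"
      using int by (rule integrable_mult_right)
    show "(\<lambda>x. (indicator K x * g x) * \<phi> x) \<in> borel_measurable lebesgue"
    proof (rule borel_measurable_times)
      show "(\<lambda>x. indicator K x * g x) \<in> borel_measurable lebesgue"
        using int by (rule borel_measurable_integrable)
      show "\<phi> \<in> borel_measurable lebesgue"
        using cont by (intro measurable_completion) (simp add: borel_measurable_continuous_onI)
    qed
    show "AE x in lebesgue. norm (indicator K x * g x * \<phi> x) \<le> norm (M * (indicator K x * g x))"
    proof (intro AE_I2)
      fix x
      show "norm (indicator K x * g x * \<phi> x) \<le> norm (M * (indicator K x * g x))"
      proof (cases "x \<in> K")
        case True
        then have "\<bar>\<phi> x\<bar> \<le> \<bar>M\<bar>" using M [OF True] by linarith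
        then show ?thesis
          using True by (simp add: abs_mult mult.commute mult_right_mono)
      qed auto
    qed
  qed
  moreover have "(\<lambda>x. (indicator K x * g x) * \<phi> x) = (\<lambda>x. indicator \<Omega> x *\<^sub>R (g x * \<phi> x))"
    using K by (fastforce simp: indicator_def fun_eq_iff)
  ultimately show ?thesis
    by (simp add: set_integrable_def)
qed

lemma has_weak_deriv_unique:
  assumes "open \<Omega>" "has_weak_deriv \<Omega> is u g" "has_weak_deriv \<Omega> is u h"
  shows "AE x in lebesgue. x \<in> \<Omega> \<longrightarrow> g x = h x"
proof -
  have loc: "locally_integrable \<Omega> g" "locally_integrable \<Omega> h"
    using assms by (auto simp: has_weak_deriv_def)
  have "AE x in lebesgue. x \<in> \<Omega> \<longrightarrow> g x - h x = 0"
  proof (rule fundamental_lemma_calculus_of_variations [OF assms(1)])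
    show "locally_integrable \<Omega> (\<lambda>x. g x - h x)"
      using loc by (simp add: locally_integrable_def set_integral_diff(1))
    fix \<phi> assume \<phi>: "\<phi> \<in> test_functions \<Omega>"
    have "(LINT x:\<Omega>|lebesgue. u x * iterated_partial is \<phi> x) =
        (-1) ^ length is * (LINT x:\<Omega>|lebesgue. g x * \<phi> x)"
      "(LINT x:\<Omega>|lebesgue. u x * iterated_partial is \<phi> x) =
        (-1) ^ length is * (LINT x:\<Omega>|lebesgue. h x * \<phi> x)"
      using assms(2,3) \<phi> unfolding has_weak_deriv_def by blast+
    then have "(LINT x:\<Omega>|lebesgue. g x * \<phi> x) = (LINT x:\<Omega>|lebesgue. h x * \<phi> x)"
      by simp
    moreover have "(LINT x:\<Omega>|lebesgue. g x * \<phi> x - h x * \<phi> x) =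
        (LINT x:\<Omega>|lebesgue. g x * \<phi> x) - (LINT x:\<Omega>|lebesgue. h x * \<phi> x)"
      by (intro set_integral_diff locally_integrable_times_test_function loc \<phi>)
    ultimately show "(LINT x:\<Omega>|lebesgue. (g x - h x) * \<phi> x) = 0"
      by (simp add: left_diff_distrib)
  qed
  then show ?thesis by simp
qed

text \<open>
  The constant \<open>weak_deriv\<close> is an arbitrary choice; uniqueness is what allows any known weak
  derivative to replace it under an integral.
\<close>
lemma weak_deriv_AE_eq:
  assumes "open \<Omega>" "has_weak_deriv \<Omega> is u g"
  shows "AE x in lebesgue. x \<in> \<Omega> \<longrightarrow> weak_deriv \<Omega> is u x = g x"
proof -
  have "has_weak_deriv \<Omega> is u (weak_deriv \<Omega> is u)"
    unfolding weak_deriv_def by (rule someI [of "has_weak_deriv \<Omega> is u", OF assms(2)])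
  from has_weak_deriv_unique [OF assms(1) this assms(2)] show ?thesis .
qed

text \<open>
  Even the chosen derivatives of the zero function are only zero almost everywhere, so this too rests
  on uniqueness. It makes a test function its own approximation in \<open>H\<^sub>0\<close>.
\<close>
lemma sobolev_norm_zero:
  assumes "open \<Omega>"
  shows "sobolev_norm k \<Omega> (\<lambda>_. 0) = 0"
proof -
  have "(LINT x:\<Omega>|lebesgue. (weak_deriv \<Omega> is (\<lambda>_. 0) x)\<^sup>2) = 0" for "is"
  proof -
    have "has_weak_deriv \<Omega> is (\<lambda>_. 0) (\<lambda>_. 0)"
      by (simp add: has_weak_deriv_def locally_integrable_def set_integrable_def)
    from weak_deriv_AE_eq [OF assms this]
    have "AE x in lebesgue. indicator \<Omega> x *\<^sub>R (weak_deriv \<Omega> is (\<lambda>_. 0) x)\<^sup>2 = 0"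
      by (rule eventually_mono) auto
    then show ?thesis
      unfolding set_lebesgue_integral_def by (rule integral_eq_zero_AE)
  qed
  then show ?thesis by (simp add: sobolev_norm_def)
qed

lemma test_function_sobolev_H0:
  assumes "\<phi> \<in> test_functions \<Omega>" "open \<Omega>" "bounded \<Omega>"
  shows "\<phi> \<in> sobolev_H0 k \<Omega>"
proof -
  have "\<phi> \<in> sobolev_H k \<Omega>"
    using assms by (intro smooth_sobolev_H test_function_smooth)
  moreover have "\<forall>e>0. sobolev_norm k \<Omega> (\<lambda>x. \<phi> x - \<phi> x) < e"
    using sobolev_norm_zero [OF assms(2)] by simp
  ultimately show ?thesis
    using assms(1) unfolding sobolev_H0_def by blast
qed

lemma has_weak_deriv_cmult:
  assumes "has_weak_deriv \<Omega> is u g"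
  shows "has_weak_deriv \<Omega> is (\<lambda>x. c * u x) (\<lambda>x. c * g x)"
  using assms by (auto simp: has_weak_deriv_def locally_integrable_def mult.assoc mult.left_commute [of _ c])

text \<open>
  The right-hand side contains only classical derivatives of \<open>h\<close>, so the energy scales with \<open>c\<^sup>2\<close>
  with a constant that is independent of \<open>c\<close>.
\<close>
lemma integral_weak_laplacian_cmult_smooth:
  assumes "open \<Omega>" "smooth h"
  shows "(LINT x:\<Omega>|lebesgue. (weak_laplacian \<Omega> (\<lambda>x. c * h x) x)\<^sup>2) =
    c\<^sup>2 * (LINT x:\<Omega>|lebesgue. (\<Sum>i\<in>UNIV. iterated_partial [i, i] h x)\<^sup>2)"
proof -
  let ?L = "\<lambda>x. \<Sum>i\<in>UNIV. iterated_partial [i, i] h x"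
  let ?F = "\<lambda>x. indicator \<Omega> x *\<^sub>R (c\<^sup>2 * (?L x)\<^sup>2)"
  have "AE x in lebesgue. \<forall>i\<in>UNIV. x \<in> \<Omega> \<longrightarrow>
      weak_deriv \<Omega> [i, i] (\<lambda>x. c * h x) x = c * iterated_partial [i, i] h x"
  proof (intro AE_finite_allI)
    fix i
    have "has_weak_deriv \<Omega> [i, i] h (iterated_partial [i, i] h)"
      using smooth_has_weak_deriv [OF assms(2), of \<Omega> "[i, i]"] by simp
    from weak_deriv_AE_eq [OF assms(1) has_weak_deriv_cmult [OF this]]
    show "AE x in lebesgue. x \<in> \<Omega> \<longrightarrow>
      weak_deriv \<Omega> [i, i] (\<lambda>x. c * h x) x = c * iterated_partial [i, i] h x" .
  qed simp
  then have AE: "AE x in lebesgue. ?F x = indicator \<Omega> x *\<^sub>R (weak_laplacian \<Omega> (\<lambda>x. c * h x) x)\<^sup>2"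
    by (rule eventually_mono)
      (auto simp: weak_laplacian_def indicator_def power_mult_distrib sum_distrib_left [symmetric])
  have "continuous_on UNIV ?L"
    by (intro continuous_on_sum smooth_continuous smooth_iterated_partial assms)
  then have [measurable]: "?L \<in> borel_measurable borel"
    by (rule borel_measurable_continuous_onI)
  have meas: "?F \<in> borel_measurable lebesgue"
    using assms(1) by (intro measurable_completion) measurable
  have "(LINT x:\<Omega>|lebesgue. (weak_laplacian \<Omega> (\<lambda>x. c * h x) x)\<^sup>2) = integral\<^sup>L lebesgue ?F"
    unfolding set_lebesgue_integral_def
    using borel_measurable_AE [OF meas AE] meas AE
    by (intro integral_cong_AE) (auto elim: eventually_mono)
  also have "\<dots> = c\<^sup>2 * (LINT x:\<Omega>|lebesgue. (?L x)\<^sup>2)"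
    by (simp add: set_lebesgue_integral_def mult.left_commute [of _ "c\<^sup>2"])
  finally show ?thesis .
qed

section \<open>The cutoff and the competitor\<close>

text \<open>
  The standard partition-of-unity quotient in terms of \<open>\<bar>x\<bar>\<^sup>2\<close>: the two summands of the denominator
  are positive for \<open>\<bar>x\<bar> < 2\<close> and for \<open>\<bar>x\<bar> > 1\<close> respectively, so it never vanishes. Using the squared
  norm avoids the singularity of the norm at the origin.
\<close>
definition cutoff :: "real ^ 'n \<Rightarrow> real" where
  "cutoff x = flat 0 (4 - (norm x)\<^sup>2) * inverse (flat 0 (4 - (norm x)\<^sup>2) + flat 0 ((norm x)\<^sup>2 - 1))"

lemma cutoff_smooth_expr: "cutoff \<in> smooth_expr"
proof -
  have "flat 0 (4 - (norm x)\<^sup>2) + flat 0 ((norm x)\<^sup>2 - 1) > 0" for x :: "real ^ 'n"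
  proof (cases "(norm x)\<^sup>2 < 4")
    case True
    then show ?thesis by (intro add_pos_nonneg flat_pos) auto
  next
    case False
    then show ?thesis by (intro add_nonneg_pos flat_pos) auto
  qed
  then have "flat 0 (4 - (norm x)\<^sup>2) + flat 0 ((norm x)\<^sup>2 - 1) \<noteq> 0" for x :: "real ^ 'n"
    by (metis less_irrefl)
  then show ?thesis
    unfolding cutoff_def
    by (intro smooth_expr.mult smooth_expr.inverse smooth_expr.add smooth_expr.flat
        smooth_expr_diff smooth_expr.const smooth_expr_norm_square)
qed

lemma cutoff_eq_1:
  assumes "norm x \<le> 1"
  shows "cutoff x = 1"
proof -
  have "(norm x)\<^sup>2 \<le> 1"
    using assms by (simp add: power_le_one)
  then have "flat 0 ((norm x)\<^sup>2 - 1) = 0" "flat 0 (4 - (norm x)\<^sup>2) > 0"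
    by (auto intro: flat_pos)
  then show ?thesis by (simp add: cutoff_def)
qed

lemma cutoff_eq_0:
  assumes "norm x \<ge> 2"
  shows "cutoff x = 0"
proof -
  have "2\<^sup>2 \<le> (norm x)\<^sup>2"
    using assms by (intro power_mono) auto
  then show ?thesis by (simp add: cutoff_def)
qed

theorem lemma9:
  fixes w :: "real \<Rightarrow> real ^ 'n \<Rightarrow> real"
  defines "w \<equiv> \<lambda>\<epsilon> x. \<epsilon> * (norm x)\<^sup>2"
  shows "(\<forall>\<epsilon>>0. w \<epsilon> \<in> sobolev_H_loc 2 UNIV) \<and>
         (\<exists>\<epsilon>\<^sub>0>0. \<forall>\<epsilon>\<in>{0<..<\<epsilon>\<^sub>0}. \<not> global_minimizer (w \<epsilon>))"
proof
  show "\<forall>\<epsilon>>0. w \<epsilon> \<in> sobolev_H_loc 2 UNIV"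
  proof (intro allI impI)
    fix \<epsilon> :: real
    have "smooth (w \<epsilon>)"
      unfolding w_def by (intro smooth_expr_smooth smooth_expr_cmult smooth_expr_norm_square)
    moreover have "bounded V" if "compact (closure V)" for V :: "(real ^ 'n) set"
      by (rule bounded_subset [OF compact_imp_bounded [OF that] closure_subset])
    ultimately show "w \<epsilon> \<in> sobolev_H_loc 2 UNIV"
      by (auto simp: sobolev_H_loc_def intro: smooth_sobolev_H)
  qed
next
  \<comment> \<open>The radius leaves room for \<open>cball 0 2\<close>, outside which the cutoff vanishes.\<close>
  define \<Omega> :: "(real ^ 'n) set" where "\<Omega> = ball 0 3"
  have \<Omega>: "open \<Omega>" "bounded \<Omega>" "\<Omega> \<in> lmeasurable"
    by (auto simp: \<Omega>_def)
  define h :: "real ^ 'n \<Rightarrow> real" where "h x = (norm x)\<^sup>2 * (1 - cutoff x)" for x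
  have "h \<in> smooth_expr"
    unfolding h_def
    by (intro smooth_expr.mult smooth_expr_diff smooth_expr.const smooth_expr_norm_square cutoff_smooth_expr)
  then have h: "smooth h" "smooth (\<lambda>x. c * h x)" for c
    by (auto intro: smooth_expr_smooth smooth_expr_cmult)
  define C where "C = (LINT x:\<Omega>|lebesgue. (\<Sum>i\<in>UNIV. iterated_partial [i, i] h x)\<^sup>2)"
  have "C \<ge> 0"
    unfolding C_def set_lebesgue_integral_def by (intro Bochner_Integration.integral_nonneg) auto
  \<comment> \<open>The measure gained by the competitor, which vanishes on the unit ball.\<close>
  define m where "m = measure lebesgue (ball (0 :: real ^ 'n) 1)"
  have "m > 0"
    unfolding m_def by (simp add: content_ball_pos)
  \<comment> \<open>Below this threshold the energy \<open>\<epsilon>\<^sup>2 C\<close> is smaller than the gain \<open>m\<close>; adding 1 covers \<open>C = 0\<close>.\<close>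
  define \<epsilon>\<^sub>0 where "\<epsilon>\<^sub>0 = sqrt (m / (C + 1))"
  show "\<exists>\<epsilon>\<^sub>0>0. \<forall>\<epsilon>\<in>{0<..<\<epsilon>\<^sub>0}. \<not> global_minimizer (w \<epsilon>)"
  proof (intro exI conjI ballI notI)
    show "\<epsilon>\<^sub>0 > 0"
      using \<open>C \<ge> 0\<close> \<open>m > 0\<close> by (simp add: \<epsilon>\<^sub>0_def)
    fix \<epsilon> assume \<epsilon>: "\<epsilon> \<in> {0<..<\<epsilon>\<^sub>0}" and min: "global_minimizer (w \<epsilon>)"
    define v where "v = (\<lambda>x. \<epsilon> * h x)"
    have "(\<lambda>x. - \<epsilon> * (norm x)\<^sup>2 * cutoff x) \<in> test_functions \<Omega>"
    proof (rule smooth_test_function)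
      show "smooth (\<lambda>x::real^'n. - \<epsilon> * (norm x)\<^sup>2 * cutoff x)"
        by (intro smooth_expr_smooth smooth_expr.mult smooth_expr.const smooth_expr_norm_square
            cutoff_smooth_expr)
      show "compact (cball (0 :: real ^ 'n) 2)" "cball 0 2 \<subseteq> \<Omega>"
        by (auto simp: \<Omega>_def)
    qed (auto intro: cutoff_eq_0)
    then have "(\<lambda>x. - \<epsilon> * (norm x)\<^sup>2 * cutoff x) \<in> sobolev_H0 2 \<Omega>"
      using \<Omega> by (intro test_function_sobolev_H0)
    moreover have "(\<lambda>x. - \<epsilon> * (norm x)\<^sup>2 * cutoff x) = (\<lambda>x. v x - w \<epsilon> x)"
      by (simp add: v_def h_def w_def algebra_simps)
    moreover have "v \<in> sobolev_H 2 \<Omega>"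
      unfolding v_def using h \<Omega> by (intro smooth_sobolev_H)
    ultimately have le: "alt_caffarelli (w \<epsilon>) \<Omega> \<le> alt_caffarelli v \<Omega>"
      using min \<Omega> by (simp add: global_minimizer_def)
    have "measure lebesgue \<Omega> \<le> alt_caffarelli (w \<epsilon>) \<Omega>"
    proof -
      have "{x \<in> \<Omega>. w \<epsilon> x \<noteq> 0} = \<Omega> - {0}"
        using \<epsilon> by (auto simp: w_def)
      moreover have "measure lebesgue (\<Omega> - {0}) = measure lebesgue \<Omega>"
        using \<Omega> by (intro measure_Diff_null_set) auto
      moreover have "(LINT x:\<Omega>|lebesgue. (weak_laplacian \<Omega> (w \<epsilon>) x)\<^sup>2) \<ge> 0"
        unfolding set_lebesgue_integral_def by (intro Bochner_Integration.integral_nonneg) auto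
      ultimately show ?thesis by (simp add: alt_caffarelli_def)
    qed
    also note le
    also have "alt_caffarelli v \<Omega> \<le> \<epsilon>\<^sup>2 * C + (measure lebesgue \<Omega> - m)"
    proof -
      have "open (\<Omega> \<inter> v -` (- {0}))"
        unfolding v_def using \<Omega>(1) h(2) by (intro open_Int open_vimage smooth_continuous) auto
      moreover have "\<Omega> \<inter> v -` (- {0}) = {x \<in> \<Omega>. v x \<noteq> 0}"
        by auto
      ultimately have meas: "{x \<in> \<Omega>. v x \<noteq> 0} \<in> sets lebesgue"
        by simp
      have "v x = 0" if "x \<in> ball 0 1" for x
        using that by (simp add: v_def h_def cutoff_eq_1)
      then have sub: "{x \<in> \<Omega>. v x \<noteq> 0} \<subseteq> \<Omega> - ball 0 1"
        by blast
      have "\<Omega> - ball 0 1 \<in> lmeasurable"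
        using \<Omega>(3) by (intro fmeasurable_Diff) auto
      then have "measure lebesgue {x \<in> \<Omega>. v x \<noteq> 0} \<le> measure lebesgue (\<Omega> - ball 0 1)"
        by (rule measure_mono_fmeasurable [OF sub meas])
      also have "\<dots> = measure lebesgue \<Omega> - m"
        unfolding m_def
        by (rule measurable_measure_Diff [OF \<Omega>(3)]) (simp_all add: \<Omega>_def subset_ball)
      finally show ?thesis
        unfolding alt_caffarelli_def v_def C_def
          integral_weak_laplacian_cmult_smooth [OF \<Omega>(1) h(1)]
        by (rule add_left_mono)
    qed
    finally have "m \<le> \<epsilon>\<^sup>2 * C" by simp
    moreover have "\<epsilon>\<^sup>2 < m / (C + 1)"
      using \<epsilon> \<open>C \<ge> 0\<close> \<open>m > 0\<close> power_strict_mono [of \<epsilon> \<epsilon>\<^sub>0 2] by (simp add: \<epsilon>\<^sub>0_def)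
    then have "\<epsilon>\<^sup>2 * (C + 1) < m"
      using \<open>C \<ge> 0\<close> by (simp add: pos_less_divide_eq)
    ultimately show False
      using zero_le_power2 [of \<epsilon>] by (simp add: algebra_simps)
  qed
qed

end
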